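(* Let $m,n$ be positive integers and, for $i=1,\dots,m$, let $f_i:\mathbb{R}^n\to\mathbb{R}$ and $X_i\subseteq\mathbb{R}^n$. Let $\{a_j^i(k)\}_{k\ge 0}$ ($i,j=1,\dots,m$) and $\{c(k)\}_{k\ge0}$ be sequences of real numbers. Assume: (1) [Convexity] for each $i$, the function $f_i$ and the set $X_i$ are convex. (2) [Connectivity and communication] With $V=\{1,\dots,m\}$, $E_k=\{(j,i): a_j^i(k)>0\}$ and $E_\infty=\{(j,i):(j,i)\in E_k\text{ for infinitely many }k\}$, the directed graph $(V,E_\infty)$ is strongly connected, and there exists an integer $T\ge1$ such that for every $(j,i)\in E_\infty$ agent $i$ receives information from agent $j$ at least once every $T$ consecutive iterations (i.e. for every $k\ge 0$ there is $r\in\{k,\dots,k+T-1\}$ with $(j,i)\in E_r$). (3) [Compactness] each $X_i$ is compact. (4) [Interior point] there exist $\bar x\in\bigcap_{i=1}^m X_i$ and $\rho>0$ such that $\{x\in\mathbb{R}^n:\|x-\bar x\|<\rho\}\subset\bigcap_{i=1}^m X_i$. (5) [Coefficients] $c(k)>0$ for all $k\ge 0$, $\{c(k)\}_{k\ge0}$ is non-increasing, $\sum_{k=0}^\infty c(k)=\infty$ and $\sum_{k=0}^\infty c(k)^2<\infty$. (6) [Weights] there exists $\eta\in(0,1)$ such that for all $i,j$ and all $k\ge0$: $a_j^i(k)\ge0$, $a_i^i(k)\ge\eta$, and $a_j^i(k)>0$ implies $a_j^i(k)\ge\eta$; moreover, for all $k\ge 0$, $\sum_{j=1}^m a_j^i(k)=1$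 for all $i$ and $\sum_{i=1}^m a_j^i(k)=1$ for all $j$. Let $x_i(0)\in X_i$ for $i=1,\dots,m$ and let the iterates $x_i(k)$ be generated, for all $k\ge 0$ and $i=1,\dots,m$, by $$z_i(k)=\sum_{j=1}^m a_j^i(k)x_j(k),\qquad x_i(k+1)=\arg\min_{x_i\in X_i}\; f_i(x_i)+\frac{1}{2c(k)}\|z_i(k)-x_i\|^2 .$$ Let $X^*$ be the set of minimizers of $\min_{x\in\mathbb{R}^n}\sum_{i=1}^m f_i(x)$ subject to $x\in\bigcap_{i=1}^m X_i$. Then, for some $x^*\in X^*$, $$\lim_{k\to\infty}\|x_i(k)-x^*\|=0\quad\text{for all } i=1,\dots,m.$$
   Context: $\|\cdot\|$ is the Euclidean norm on $\mathbb{R}^n$. The $m$ indices are called agents; $(j,i)\in E_k$ means that agent $i$ receives information from agent $j$ at iteration $k$. *)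

theory Defs
  imports "Graph_Theory.Digraph_Component" "HOL-Analysis.Analysis"
begin

text \<open>The real number \<open>a i j k\<close> is the weight that agent \<open>i\<close> gives to agent \<open>j\<close> at iteration \<open>k\<close>,
  usually written $a_j^i(k)$. The agents are \<open>1, \<dots>, m\<close>, and an edge \<open>(j, i)\<close> points from the sender
  \<open>j\<close> to the receiver \<open>i\<close>.\<close>

definition edges_at :: "nat \<Rightarrow> (nat \<Rightarrow> nat \<Rightarrow> nat \<Rightarrow> real) \<Rightarrow> nat \<Rightarrow> (nat \<times> nat) set" where
  "edges_at m a k = {(j, i). j \<in> {1..m} \<and> i \<in> {1..m} \<and> a i j k > 0}"

definition edges_inf :: "nat \<Rightarrow> (nat \<Rightarrow> nat \<Rightarrow> nat \<Rightarrow> real) \<Rightarrow> (nat \<times> nat) set" where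
  "edges_inf m a = {(j, i). infinite {k. (j, i) \<in> edges_at m a k}}"

definition graph_inf :: "nat \<Rightarrow> (nat \<Rightarrow> nat \<Rightarrow> nat \<Rightarrow> real) \<Rightarrow> nat pair_pre_digraph" where
  "graph_inf m a = \<lparr>pverts = {1..m}, parcs = edges_inf m a\<rparr>"

definition minimizers ::
  "nat \<Rightarrow> (nat \<Rightarrow> real ^ 'n \<Rightarrow> real) \<Rightarrow> (nat \<Rightarrow> (real ^ 'n) set) \<Rightarrow> (real ^ 'n) set" where
  "minimizers m f X =
     {x. is_arg_min (\<lambda>y. \<Sum>i=1..m. f i y) (\<lambda>y. y \<in> (\<Inter>i\<in>{1..m}. X i)) x}"

end

theory Submission
  imports Defs
begin

text \<open>
  Write \<open>W k\<close> for the squared distance of the iterates from their mean, \<open>P k\<close> for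
  \<open>\<Sum>i. \<parallel>x i (k + 1) - z i k\<parallel>\<^sup>2\<close>, and \<open>d k\<close> for the amount \<open>\<Sum>i j. a i j k * \<parallel>x j k - z i k\<parallel>\<^sup>2\<close> by which
  doubly stochastic averaging decreases the sum of squared distances to any fixed point.
  By strong connectivity, \<open>W k\<close> is at most a constant times the sum of \<open>d + P\<close> over a window of length \<open>T\<close>;
  since \<open>d\<close> telescopes against \<open>W\<close>, the partial sums of \<open>W\<close> are bounded by those of \<open>P\<close> up to constants.
  The interior point provides a feasible \<open>p k\<close> within \<open>O(sqrt (W k))\<close> of all iterates, and the proximal
  inequality then shows that, for feasible \<open>y\<close>, the sum \<open>D k\<close> of squared distances of the iterates to \<open>y\<close> satisfies
  \<open>D (k + 1) + P k + 2 * c k * (F (p (k + 1)) - F y) \<le> D k + O(c k * sqrt (W (k + 1)))\<close>.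
  Splitting the last term into \<open>\<alpha> * W (k + 1) + O((c k)\<^sup>2)\<close> with small \<open>\<alpha>\<close> allows \<open>P\<close> to absorb \<open>W\<close>. Hence \<open>P\<close> and \<open>W\<close>
  are summable, \<open>D\<close> converges for every minimizer \<open>y\<close>, and, as \<open>\<Sum>k. c k\<close> diverges, \<open>F (p k)\<close> comes arbitrarily close to
  the minimum; a cluster point of \<open>p\<close> along which it does is the limit.
\<close>

section \<open>Squared distances and averages\<close>

text \<open>The parallel axis identity: expanding each square around the weighted average leaves a
  cross term that vanishes, since the weighted deviations from that average sum to zero. Applied to
  one row of weights, the last sum is that agent's share of the dissipation.\<close>

lemma sum_norm_diff_convex_combination:
  fixes p :: "'i \<Rightarrow> 'b::real_inner"
  assumes "sum u I = 1"
  shows "(\<Sum>j\<in>I. u j * (norm (p j - y))\<^sup>2) =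
    (norm ((\<Sum>j\<in>I. u j *\<^sub>R p j) - y))\<^sup>2 +
    (\<Sum>j\<in>I. u j * (norm (p j - (\<Sum>j\<in>I. u j *\<^sub>R p j)))\<^sup>2)"
proof -
  define q where "q = (\<Sum>j\<in>I. u j *\<^sub>R p j)"
  have "(\<Sum>j\<in>I. u j *\<^sub>R (p j - q)) = 0"
    using assms
    by (simp add: scaleR_diff_right sum_subtractf q_def flip: scaleR_left.sum)
  then have cross: "(\<Sum>j\<in>I. u j * ((p j - q) \<bullet> (q - y))) = 0"
    by (metis (no_types, lifting) inner_scaleR_left inner_sum_left inner_zero_left sum.cong)
  have "(norm (p j - y))\<^sup>2 = (norm (q - y))\<^sup>2 + (norm (p j - q))\<^sup>2 + 2 * ((p j - q) \<bullet> (q - y))" for j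
    by (simp add: power2_norm_eq_inner algebra_simps inner_commute)
  then have "u j * (norm (p j - y))\<^sup>2 =
      u j * (norm (q - y))\<^sup>2 + u j * (norm (p j - q))\<^sup>2 + 2 * (u j * ((p j - q) \<bullet> (q - y)))" for j
    by (simp only: distrib_left mult.left_commute)
  then have "(\<Sum>j\<in>I. u j * (norm (p j - y))\<^sup>2) =
      (\<Sum>j\<in>I. u j * (norm (q - y))\<^sup>2 + u j * (norm (p j - q))\<^sup>2 + 2 * (u j * ((p j - q) \<bullet> (q - y))))"
    by (simp only:)
  also have "\<dots> = (norm (q - y))\<^sup>2 + (\<Sum>j\<in>I. u j * (norm (p j - q))\<^sup>2)"
    using assms cross by (simp add: sum.distrib flip: sum_distrib_right sum_distrib_left)
  finally show ?thesis unfolding q_def .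
qed

lemma sum_norm_diff_mean_le:
  fixes p :: "'i \<Rightarrow> 'b::real_inner"
  assumes "finite I" "I \<noteq> {}"
  shows "(\<Sum>j\<in>I. (norm (p j - (\<Sum>i\<in>I. p i) /\<^sub>R real (card I)))\<^sup>2) \<le> (\<Sum>j\<in>I. (norm (p j - y))\<^sup>2)"
proof -
  define q where "q = (\<Sum>i\<in>I. p i) /\<^sub>R real (card I)"
  have c: "real (card I) > 0" using assms by (simp add: card_gt_0_iff)
  have "(\<Sum>j\<in>I. inverse (real (card I)) * (norm (p j - q))\<^sup>2)
      \<le> (\<Sum>j\<in>I. inverse (real (card I)) * (norm (p j - y))\<^sup>2)"
    using sum_norm_diff_convex_combination[of "\<lambda>_. inverse (real (card I))" I p y] c
    by (simp add: q_def flip: scaleR_right.sum)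
  then show ?thesis
    using c by (simp flip: sum_distrib_left add: q_def)
qed

section \<open>Sums and real sequences\<close>

text \<open>For each fixed \<open>t\<close>, the shift by \<open>Suc t\<close> is injective and
  stays below \<open>N + T\<close>; there are \<open>T\<close> such shifts.\<close>

lemma sum_window_le:
  fixes h :: "nat \<Rightarrow> real"
  assumes "\<And>k. h k \<ge> 0"
  shows "(\<Sum>k<N. \<Sum>t<T. h (Suc k + t)) \<le> T * (\<Sum>k<N + T. h k)"
proof -
  have "(\<Sum>k<N. h (Suc k + t)) \<le> (\<Sum>k<N + T. h k)" if "t < T" for t
  proof -
    have "(\<Sum>k<N. h (Suc k + t)) = sum h ((\<lambda>k. Suc k + t) ` {..<N})"
      by (subst sum.reindex) (auto simp: inj_on_def)
    also have "\<dots> \<le> (\<Sum>k<N + T. h k)"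
      using that assms by (intro sum_mono2) auto
    finally show ?thesis .
  qed
  then have "(\<Sum>t<T. \<Sum>k<N. h (Suc k + t)) \<le> (\<Sum>t<T. \<Sum>k<N + T. h k)"
    by (intro sum_mono) auto
  then show ?thesis
    by (subst sum.swap) simp
qed

lemma sum_add_le_of_bounded:
  fixes h :: "nat \<Rightarrow> real"
  assumes "\<And>k. h k \<le> b"
  shows "(\<Sum>k<N + T. h k) \<le> (\<Sum>k<N. h k) + T * b"
proof (induction T)
  case (Suc T)
  then show ?case using assms[of "N + T"] by (simp add: algebra_simps)
qed simp

text \<open>Subtracting the partial sums of \<open>b\<close> turns \<open>u\<close> into a
  non-increasing sequence, which is bounded below because those partial sums are bounded.\<close>

lemma quasi_Fejer_convergent:
  fixes u b :: "nat \<Rightarrow> real"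
  assumes "\<And>k. u k \<ge> 0" "\<And>k. u (Suc k) \<le> u k + b k" "summable b"
  shows "convergent u"
proof -
  define s where "s k = u k - (\<Sum>j<k. b j)" for k
  have lim: "(\<lambda>k. \<Sum>j<k. b j) \<longlonglongrightarrow> suminf b"
    using assms(3) by (rule summable_LIMSEQ)
  then obtain K where K: "\<And>k. norm (\<Sum>j<k. b j) \<le> K"
    using convergentI[OF lim] convergent_imp_Bseq BseqE by metis
  have "decseq s"
    using assms(2) by (auto intro!: decseq_SucI simp: s_def algebra_simps)
  moreover have "- K \<le> s k" for k
    using K[of k] assms(1)[of k] by (simp add: s_def)
  ultimately obtain l where "s \<longlonglongrightarrow> l"
    using decseq_convergent by blast
  then have "(\<lambda>k. s k + (\<Sum>j<k. b j)) \<longlonglongrightarrow> l + suminf b"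
    using lim by (rule tendsto_add)
  then show ?thesis
    by (simp add: s_def convergentI)
qed

text \<open>If \<open>g\<close> stayed above \<epsilon> from \<open>n\<close> on, the weighted sums
  would grow at least like \<epsilon> times the divergent sums of \<open>c\<close>.\<close>

lemma frequently_small_of_weighted_sum_bounded:
  fixes c g :: "nat \<Rightarrow> real"
  assumes "\<And>k. c k > 0" "filterlim (\<lambda>N. \<Sum>k<N. c k) at_top sequentially"
    and bd: "\<And>N. (\<Sum>k<N. c k * g k) \<le> B" and "\<epsilon> > 0"
  shows "\<exists>k\<ge>n. g k < \<epsilon>"
proof (rule ccontr)
  assume "\<not> ?thesis"
  then have ge: "\<And>k. k \<ge> n \<Longrightarrow> \<epsilon> \<le> g k" by (meson not_less)
  \<comment> \<open>\<open>R\<close> accounts for the first \<open>n\<close> terms, on which nothing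
    is known about \<open>g\<close>.\<close>
  define R where "R = (\<Sum>k<n. c k * g k) - \<epsilon> * (\<Sum>k<n. c k)"
  have "R + \<epsilon> * (\<Sum>k<N. c k) \<le> B" if "n \<le> N" for N
  proof -
    have "(\<Sum>k<N. c k * g k) - \<epsilon> * (\<Sum>k<N. c k) \<ge> R"
      using that
    proof (induction N rule: dec_induct)
      case (step N)
      have "c N * \<epsilon> \<le> c N * g N"
        using ge[of N] step assms(1)[of N] by (intro mult_left_mono) auto
      then show ?case using step by (simp add: algebra_simps)
    qed (simp add: R_def)
    then show ?thesis using bd[of N] by simp
  qed
  moreover have "\<forall>\<^sub>F N in sequentially. (B - R) / \<epsilon> + 1 \<le> (\<Sum>k<N. c k)"
    using assms(2) by (simp add: filterlim_at_top)
  then have "\<forall>\<^sub>F N in sequentially. n \<le> N \<and> (B - R) / \<epsilon> + 1 \<le> (\<Sum>k<N. c k)"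
    by (intro eventually_conj eventually_ge_at_top)
  then obtain N where "n \<le> N" "(B - R) / \<epsilon> + 1 \<le> (\<Sum>k<N. c k)"
    by (auto simp: eventually_sequentially)
  ultimately show False
    using \<open>\<epsilon> > 0\<close> by (smt (verit, best) divide_less_eq mult.commute)
qed

section \<open>Convex functions, proximal points and convex sets\<close>

text \<open>Prolonging the segment from \<open>z\<close> to \<open>y\<close> by length 1 stays in
  the ball of radius \<open>B + 1\<close>, where \<open>f\<close> is bounded by compactness;
  convexity on the prolonged segment then bounds the slope between \<open>z\<close> and
  \<open>y\<close>.\<close>

lemma convex_on_UNIV_imp_lipschitz_cball:
  fixes f :: "'b::euclidean_space \<Rightarrow> real"
  assumes "convex_on UNIV f"
  obtains L where "L \<ge> 0" "\<And>y z. norm y \<le> B \<Longrightarrow> norm z \<le> B \<Longrightarrow> f y - f z \<le> L * norm (y - z)"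
proof -
  have "continuous_on (cball 0 (B + 1)) f"
    using convex_on_continuous[OF open_UNIV assms] continuous_on_subset by blast
  then have "bounded (f ` cball 0 (B + 1))"
    by (intro compact_imp_bounded compact_continuous_image) auto
  then obtain M where "\<forall>v\<in>f ` cball 0 (B + 1). norm v \<le> M"
    by (auto simp: bounded_iff)
  then have M: "\<bar>f u\<bar> \<le> M" if "norm u \<le> B + 1" for u
    using that by auto
  \<comment> \<open>The absolute value keeps the constant nonnegative even if the ball is empty and
    \<open>M\<close> is arbitrary.\<close>
  have "f y - f z \<le> (2 * \<bar>M\<bar>) * norm (y - z)" if yz: "norm y \<le> B" "norm z \<le> B" for y z
  proof (cases "y = z")
    case False
    define d where "d = norm (y - z)"
    have d: "d > 0" using False by (simp add: d_def)
    define u where "u = y + (y - z) /\<^sub>R d"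
    have "norm u \<le> norm y + norm ((y - z) /\<^sub>R d)"
      unfolding u_def by (rule norm_triangle_ineq)
    also have "norm ((y - z) /\<^sub>R d) = 1"
      using d by (simp add: d_def)
    finally have u: "norm u \<le> B + 1" using yz by simp
    \<comment> \<open>This \<open>t\<close> is the position of \<open>y\<close> on the segment from
      \<open>z\<close> to \<open>u\<close>, which has length \<open>1 + d\<close>.\<close>
    define t where "t = d / (1 + d)"
    have t: "0 \<le> t" "t \<le> 1" "t \<le> d" "t * (1 + d) = d"
      using d by (auto simp: t_def divide_simps algebra_simps)
    have "(1 + d) *\<^sub>R y = (1 + d) *\<^sub>R ((1 - t) *\<^sub>R z + t *\<^sub>R u)"
    proof -
      have "(1 + d) * (1 - t) = 1" "(1 + d) * t = d" using t(4) by (auto simp: algebra_simps)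
      then have "(1 + d) *\<^sub>R ((1 - t) *\<^sub>R z + t *\<^sub>R u) = z + d *\<^sub>R u"
        by (simp add: scaleR_add_right)
      then show ?thesis using d by (simp add: u_def algebra_simps)
    qed
    then have "y = (1 - t) *\<^sub>R z + t *\<^sub>R u" using d by simp
    then have "f y \<le> (1 - t) * f z + t * f u"
      using convex_onD[OF assms, of t z u] t by simp
    then have "f y - f z \<le> t * (f u - f z)" by (simp add: algebra_simps)
    also have "\<dots> \<le> t * (2 * \<bar>M\<bar>)"
      using M[of u] M[of z] u yz t by (intro mult_left_mono) auto
    also have "\<dots> \<le> d * (2 * \<bar>M\<bar>)"
      using t by (intro mult_right_mono) auto
    finally show ?thesis by (simp add: d_def mult.commute)
  qed simp
  then show ?thesis by (intro that[of "2 * \<bar>M\<bar>"]) auto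
qed

text \<open>Comparing the minimizer \<open>p\<close> with the points at fraction \<open>t\<close> of
  the way to \<open>y\<close>, dividing by \<open>t\<close> and letting \<open>t\<close> tend to 0
  gives the variational inequality at \<open>p\<close>; expanding the square of \<open>z - y\<close>
  around \<open>p\<close> gives the three-point form.\<close>

lemma prox_inequality:
  fixes f :: "'b::real_inner \<Rightarrow> real"
  assumes f: "convex_on S f" and "convex S" and "c > 0" and "y \<in> S"
    and p: "is_arg_min (\<lambda>y. f y + 1 / (2 * c) * (norm (z - y))\<^sup>2) (\<lambda>y. y \<in> S) p"
  shows "2 * c * (f p - f y) \<le> (norm (z - y))\<^sup>2 - (norm (p - y))\<^sup>2 - (norm (p - z))\<^sup>2"
proof -
  have pS: "p \<in> S" using p by (simp add: is_arg_min_def)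
  have bound: "2 * c * (f p - f y) + 2 * ((z - p) \<bullet> (y - p)) \<le> t * (norm (y - p))\<^sup>2"
    if t: "0 < t" "t < 1" for t
  proof -
    define q where "q = (1 - t) *\<^sub>R p + t *\<^sub>R y"
    have q: "q = p + t *\<^sub>R (y - p)" by (simp add: q_def algebra_simps)
    have "q \<in> S"
      using \<open>convex S\<close> pS \<open>y \<in> S\<close> t by (simp add: q_def convexD)
    then have "f p + 1 / (2 * c) * (norm (z - p))\<^sup>2 \<le> f q + 1 / (2 * c) * (norm (z - q))\<^sup>2"
      using p by (auto simp: is_arg_min_def not_less)
    also have "f q \<le> (1 - t) * f p + t * f y"
      unfolding q_def using f pS \<open>y \<in> S\<close> t by (intro convex_onD) auto
    also have "(norm (z - q))\<^sup>2 = (norm (z - p))\<^sup>2 - 2 * t * ((z - p) \<bullet> (y - p)) + t * t * (norm (y - p))\<^sup>2"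
      unfolding q by (simp add: power2_norm_eq_inner algebra_simps inner_commute)
    finally have "t * (f p - f y) \<le> 1 / (2 * c) * (t * (t * (norm (y - p))\<^sup>2 - 2 * ((z - p) \<bullet> (y - p))))"
      by (simp add: algebra_simps power2_eq_square)
    then have "t * (2 * c * (f p - f y)) \<le> t * (t * (norm (y - p))\<^sup>2 - 2 * ((z - p) \<bullet> (y - p)))"
      using \<open>c > 0\<close> by (simp add: field_simps)
    then show ?thesis using t by simp
  qed
  have "((\<lambda>t. t * (norm (y - p))\<^sup>2) \<longlongrightarrow> 0 * (norm (y - p))\<^sup>2) (at_right 0)"
    by (intro tendsto_intros)
  moreover have "\<forall>\<^sub>F t in at_right (0::real). 2 * c * (f p - f y) + 2 * ((z - p) \<bullet> (y - p)) \<le> t * (norm (y - p))\<^sup>2"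
    using bound by (auto simp: eventually_at_right_field intro: exI[of _ 1])
  ultimately have "2 * c * (f p - f y) + 2 * ((z - p) \<bullet> (y - p)) \<le> 0 * (norm (y - p))\<^sup>2"
    by (intro tendsto_lowerbound) auto
  moreover have "(norm (z - y))\<^sup>2 = (norm (p - z))\<^sup>2 - 2 * ((z - p) \<bullet> (y - p)) + (norm (p - y))\<^sup>2"
    by (simp add: power2_norm_eq_inner algebra_simps inner_commute)
  ultimately show ?thesis by simp
qed

text \<open>The point is \<open>(s *\<^sub>R xbar + \<rho> *\<^sub>R v) /\<^sub>R (s + \<rho>)\<close>: seen from \<open>x i\<close>, it is a convex combination
  of \<open>x i\<close> and of the point \<open>xbar + (\<rho> / s) *\<^sub>R (v - x i)\<close> of the ball.\<close>
lemma near_point_in_Inter: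
  fixes x :: "'i \<Rightarrow> 'b::real_normed_vector"
  assumes "\<And>i. i \<in> I \<Longrightarrow> convex (X i)" "\<And>i. i \<in> I \<Longrightarrow> x i \<in> X i"
    and "\<And>i. i \<in> I \<Longrightarrow> cball xbar \<rho> \<subseteq> X i" and "\<rho> > 0"
    and "\<And>i. i \<in> I \<Longrightarrow> norm (x i - v) \<le> s" and "s \<ge> 0"
  obtains p where "p \<in> (\<Inter>i\<in>I. X i)" "norm (v - p) \<le> s / \<rho> * norm (v - xbar)"
proof -
  define p where "p = (s / (s + \<rho>)) *\<^sub>R xbar + (\<rho> / (s + \<rho>)) *\<^sub>R v"
  have sum1: "\<rho> / (s + \<rho>) = 1 - s / (s + \<rho>)" using assms by (simp add: field_simps)
  have "p \<in> X i" if i: "i \<in> I" for i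
  proof (cases "s = 0")
    case True
    then show ?thesis using assms(2)[OF i] assms(5)[OF i] \<open>\<rho> > 0\<close> by (simp add: p_def)
  next
    case False
    then have s: "s > 0" using assms by simp
    define q where "q = xbar + (\<rho> / s) *\<^sub>R (v - x i)"
    have "dist xbar q = \<rho> / s * norm (x i - v)"
      using s \<open>\<rho> > 0\<close> by (simp add: q_def dist_norm norm_minus_commute)
    also have "\<dots> \<le> \<rho> / s * s"
      using s \<open>\<rho> > 0\<close> assms(5)[OF i] by (intro mult_left_mono) auto
    finally have "q \<in> X i" using s assms(3)[OF i] by auto
    moreover have "p = (s / (s + \<rho>)) *\<^sub>R q + (\<rho> / (s + \<rho>)) *\<^sub>R x i"
      using s by (simp add: p_def q_def algebra_simps)
    ultimately show ?thesis
      using assms(1)[OF i] assms(2)[OF i] s \<open>\<rho> > 0\<close> sum1 by (simp add: convexD)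
  qed
  moreover have "norm (v - p) \<le> s / \<rho> * norm (v - xbar)"
  proof -
    have "v - p = (s / (s + \<rho>)) *\<^sub>R (v - xbar)"
      unfolding p_def sum1 by (simp add: algebra_simps)
    then have "norm (v - p) = s / (s + \<rho>) * norm (v - xbar)" using assms by simp
    also have "\<dots> \<le> s / \<rho> * norm (v - xbar)"
      using assms by (intro mult_right_mono divide_left_mono) auto
    finally show ?thesis .
  qed
  ultimately show ?thesis using that by auto
qed

section \<open>Consensus of perturbed averaging\<close>

text \<open>Consensus is separated from optimization: the new iterates are arbitrary bounded points,
  and their deviation from the averages \<open>z\<close> is treated as a perturbation.\<close>

locale perturbed_averaging =
  fixes I :: "'i set" and a :: "'i \<Rightarrow> 'i \<Rightarrow> nat \<Rightarrow> real"
    and x z :: "'i \<Rightarrow> nat \<Rightarrow> 'b::real_inner"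
    and E :: "('i \<times> 'i) set" and T :: nat and \<eta> B :: real
  assumes finite_I: "finite I" and I_nonempty: "I \<noteq> {}"
    and weight_nonneg: "\<And>i j k. i \<in> I \<Longrightarrow> j \<in> I \<Longrightarrow> 0 \<le> a i j k"
    and row_sum: "\<And>i k. i \<in> I \<Longrightarrow> (\<Sum>j\<in>I. a i j k) = 1"
    and col_sum: "\<And>j k. j \<in> I \<Longrightarrow> (\<Sum>i\<in>I. a i j k) = 1"
    and eta_pos: "\<eta> > 0"
    and self_weight: "\<And>i k. i \<in> I \<Longrightarrow> \<eta> \<le> a i i k"
    and z_eq: "\<And>i k. i \<in> I \<Longrightarrow> z i k = (\<Sum>j\<in>I. a i j k *\<^sub>R x j k)"
    and E_subset: "E \<subseteq> I \<times> I"
    and E_connected: "\<And>i j. i \<in> I \<Longrightarrow> j \<in> I \<Longrightarrow> (i, j) \<in> E\<^sup>*"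
    and communication: "\<And>i j k. (j, i) \<in> E \<Longrightarrow> \<exists>r\<in>{k..<k + T}. \<eta> \<le> a i j r"
    and x_bounded: "\<And>i k. i \<in> I \<Longrightarrow> norm (x i k) \<le> B"
begin

definition mean :: "nat \<Rightarrow> 'b" where
  "mean k = (\<Sum>i\<in>I. x i k) /\<^sub>R real (card I)"

definition disagreement :: "nat \<Rightarrow> real" where
  "disagreement k = (\<Sum>i\<in>I. (norm (x i k - mean k))\<^sup>2)"

definition perturbation :: "nat \<Rightarrow> real" where
  "perturbation k = (\<Sum>i\<in>I. (norm (x i (Suc k) - z i k))\<^sup>2)"

definition dissipation :: "nat \<Rightarrow> real" where
  "dissipation k = (\<Sum>i\<in>I. \<Sum>j\<in>I. a i j k * (norm (x j k - z i k))\<^sup>2)"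

lemma disagreement_nonneg: "0 \<le> disagreement k"
  and perturbation_nonneg: "0 \<le> perturbation k"
  and dissipation_nonneg: "0 \<le> dissipation k"
  by (auto simp: disagreement_def perturbation_def dissipation_def weight_nonneg intro!: sum_nonneg)

text \<open>Row sums 1 allow the parallel axis identity for each agent; after exchanging the sums,
  column sums 1 make the weights disappear.\<close>

lemma sum_norm_z_diff:
  "(\<Sum>i\<in>I. (norm (z i k - y))\<^sup>2) + dissipation k = (\<Sum>j\<in>I. (norm (x j k - y))\<^sup>2)"
proof -
  have "(\<Sum>j\<in>I. a i j k * (norm (x j k - y))\<^sup>2) =
      (norm (z i k - y))\<^sup>2 + (\<Sum>j\<in>I. a i j k * (norm (x j k - z i k))\<^sup>2)" if "i \<in> I" for i
    using sum_norm_diff_convex_combination[OF row_sum[OF that, of k], of "\<lambda>j. x j k" y]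
    by (simp add: z_eq[OF that])
  then have "(\<Sum>i\<in>I. (norm (z i k - y))\<^sup>2) + dissipation k =
      (\<Sum>i\<in>I. \<Sum>j\<in>I. a i j k * (norm (x j k - y))\<^sup>2)"
    by (simp add: dissipation_def flip: sum.distrib)
  also have "\<dots> = (\<Sum>j\<in>I. \<Sum>i\<in>I. a i j k * (norm (x j k - y))\<^sup>2)"
    by (rule sum.swap)
  also have "\<dots> = (\<Sum>j\<in>I. (norm (x j k - y))\<^sup>2)"
    by (simp add: col_sum flip: sum_distrib_right)
  finally show ?thesis .
qed

lemma norm_z_le:
  assumes "i \<in> I"
  shows "norm (z i k) \<le> B"
proof -
  have "norm (z i k) \<le> (\<Sum>j\<in>I. a i j k * B)"
    unfolding z_eq[OF assms] using assms
    by (intro sum_norm_le) (auto simp: weight_nonneg x_bounded intro!: mult_left_mono)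
  then show ?thesis by (simp add: row_sum[OF assms] flip: sum_distrib_right)
qed

lemma disagreement_le: "disagreement k \<le> (\<Sum>i\<in>I. (norm (x i k - y))\<^sup>2)"
  unfolding disagreement_def mean_def
  using sum_norm_diff_mean_le[OF finite_I I_nonempty, of "\<lambda>i. x i k"] .

lemma norm_diff_mean_le:
  assumes "i \<in> I"
  shows "norm (x i k - mean k) \<le> sqrt (disagreement k)"
  unfolding disagreement_def
  using assms finite_I
  by (intro real_le_rsqrt member_le_sum[where f = "\<lambda>i. (norm (x i k - mean k))\<^sup>2"]) auto

lemma norm_mean_le: "norm (mean k) \<le> B"
proof -
  have "norm (\<Sum>i\<in>I. x i k) \<le> (\<Sum>i\<in>I. B)"
    by (intro sum_norm_le) (rule x_bounded)
  then show ?thesis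
    using finite_I I_nonempty by (simp add: mean_def field_simps card_gt_0_iff)
qed

lemma disagreement_bounded: "disagreement k \<le> card I * B\<^sup>2"
proof -
  have "disagreement k \<le> (\<Sum>i\<in>I. (norm (x i k))\<^sup>2)"
    using disagreement_le[of k 0] by simp
  also have "\<dots> \<le> (\<Sum>i\<in>I. B\<^sup>2)"
    by (intro sum_mono power_mono) (auto simp: x_bounded)
  finally show ?thesis by simp
qed

lemma perturbation_bounded: "perturbation k \<le> card I * (2 * B)\<^sup>2"
proof -
  have "norm (x i (Suc k) - z i k) \<le> 2 * B" if "i \<in> I" for i
    using norm_triangle_ineq4[of "x i (Suc k)" "z i k"] x_bounded[OF that, of "Suc k"]
      norm_z_le[OF that, of k] by simp
  then have "perturbation k \<le> (\<Sum>i\<in>I. (2 * B)\<^sup>2)"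
    unfolding perturbation_def by (intro sum_mono power_mono) auto
  then show ?thesis by simp
qed

text \<open>The old mean can replace the new one as reference point, because the new mean minimizes
  the sum of squares; the exact identity for averaging then applies. The parameter \<beta> stays
  free so that the growth of the disagreement can be made small.\<close>

lemma dissipation_bound:
  assumes "\<beta> > 0"
  shows "disagreement (Suc k) + dissipation k
    \<le> disagreement k + \<beta> * disagreement k + (1 + 1 / \<beta>) * perturbation k"
proof -
  have young: "(norm (x i (Suc k) - mean k))\<^sup>2
      \<le> (1 + \<beta>) * (norm (z i k - mean k))\<^sup>2 + (1 + 1 / \<beta>) * (norm (x i (Suc k) - z i k))\<^sup>2" for i
  proof -
    define p q where "p = norm (z i k - mean k)" and "q = norm (x i (Suc k) - z i k)"
    have "norm (x i (Suc k) - mean k) \<le> p + q"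
      using norm_triangle_ineq[of "z i k - mean k" "x i (Suc k) - z i k"]
      by (simp add: p_def q_def)
    then have "(norm (x i (Suc k) - mean k))\<^sup>2 \<le> (p + q)\<^sup>2"
      by (intro power_mono) auto
    also have "\<dots> \<le> (1 + \<beta>) * p\<^sup>2 + (1 + 1 / \<beta>) * q\<^sup>2"
    proof -
      \<comment> \<open>Young's inequality
        \<open>2 * p * q \<le> \<beta> * p\<^sup>2 + q\<^sup>2 / \<beta>\<close>.\<close>
      have "0 \<le> (\<beta> * p - q)\<^sup>2 / \<beta>" using assms by simp
      also have "\<dots> = \<beta> * p\<^sup>2 - 2 * p * q + q\<^sup>2 / \<beta>"
        using assms by (simp add: power2_eq_square field_simps)
      finally show ?thesis by (simp add: power2_eq_square algebra_simps)
    qed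
    finally show ?thesis by (simp add: p_def q_def)
  qed
  have "disagreement (Suc k) \<le> (\<Sum>i\<in>I. (norm (x i (Suc k) - mean k))\<^sup>2)"
    by (rule disagreement_le)
  also have "\<dots> \<le> (1 + \<beta>) * (\<Sum>i\<in>I. (norm (z i k - mean k))\<^sup>2) + (1 + 1 / \<beta>) * perturbation k"
    using sum_mono[where K = I, OF young] by (simp add: perturbation_def sum.distrib sum_distrib_left)
  also have "(\<Sum>i\<in>I. (norm (z i k - mean k))\<^sup>2) = disagreement k - dissipation k"
    using sum_norm_z_diff[of k "mean k"] by (simp add: disagreement_def)
  finally have "disagreement (Suc k) + dissipation k + \<beta> * dissipation k
      \<le> disagreement k + \<beta> * disagreement k + (1 + 1 / \<beta>) * perturbation k"
    by (simp add: algebra_simps)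
  moreover have "0 \<le> \<beta> * dissipation k" using assms dissipation_nonneg by simp
  ultimately show ?thesis by linarith
qed

lemma norm_x_diff_z_le:
  assumes "i \<in> I" "j \<in> I" "\<eta> \<le> a i j k"
  shows "norm (x j k - z i k) \<le> sqrt (dissipation k / \<eta>)"
proof -
  have "\<eta> * (norm (x j k - z i k))\<^sup>2 \<le> a i j k * (norm (x j k - z i k))\<^sup>2"
    using assms by (intro mult_right_mono) auto
  also have "\<dots> \<le> (\<Sum>j\<in>I. a i j k * (norm (x j k - z i k))\<^sup>2)"
    using assms finite_I
    by (intro member_le_sum[where f = "\<lambda>j. a i j k * (norm (x j k - z i k))\<^sup>2"])
      (auto simp: weight_nonneg)
  also have "\<dots> \<le> dissipation k"
    unfolding dissipation_def using assms finite_I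
    by (intro member_le_sum[where f = "\<lambda>i. \<Sum>j\<in>I. a i j k * (norm (x j k - z i k))\<^sup>2"])
      (auto simp: weight_nonneg intro!: sum_nonneg)
  finally show ?thesis
    using eta_pos by (intro real_le_rsqrt) (simp add: field_simps)
qed

text \<open>If little is dissipated and perturbed during \<open>T\<close> steps, then every agent hardly moves, so the
  endpoints of each edge stay close to where they were when that edge was active; disagreement along
  paths of \<open>E\<close> is then small already at time \<open>k\<close>.\<close>
lemma disagreement_le_window:
  "\<exists>K\<ge>0. \<forall>k. disagreement k \<le> K * (\<Sum>t<T. dissipation (k + t) + perturbation (k + t))"
proof -
  \<comment> \<open>In one step an agent moves at most \<open>s * sqrt R\<close>:
    \<open>sqrt R / sqrt \<eta>\<close> to its average, by its self-weight, and
    \<open>sqrt R\<close> by the perturbation.\<close>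
  define s where "s = 1 / sqrt \<eta> + 1"
  \<comment> \<open>Two agents are joined by at most \<open>card E\<close> edges, each of length at
    most \<open>2 * (T + 1) * s * sqrt R\<close>; this is squared and summed over the
    agents.\<close>
  define K where "K = card I * (card E * (2 * (T + 1) * s))\<^sup>2"
  have s: "s \<ge> 0" using eta_pos by (simp add: s_def)
  have "disagreement k \<le> K * (\<Sum>t<T. dissipation (k + t) + perturbation (k + t))" for k
  proof -
    define R where "R = (\<Sum>t<T. dissipation (k + t) + perturbation (k + t))"
    define r where "r = s * sqrt R"
    have R: "R \<ge> 0"
      unfolding R_def by (intro sum_nonneg add_nonneg_nonneg dissipation_nonneg perturbation_nonneg)
    have r: "r \<ge> 0" using s R by (simp add: r_def)
    have small: "dissipation (k + t) + perturbation (k + t) \<le> R" if "t < T" for t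
      unfolding R_def using that
      by (intro member_le_sum[where f = "\<lambda>t. dissipation (k + t) + perturbation (k + t)"])
        (auto intro!: add_nonneg_nonneg dissipation_nonneg perturbation_nonneg)
    have near_z: "norm (x j (k + t) - z i (k + t)) \<le> sqrt R / sqrt \<eta>"
      if "t < T" "i \<in> I" "j \<in> I" "\<eta> \<le> a i j (k + t)" for i j t
    proof -
      have "dissipation (k + t) \<le> R"
        using small[OF that(1)] perturbation_nonneg[of "k + t"] by simp
      then have "sqrt (dissipation (k + t) / \<eta>) \<le> sqrt R / sqrt \<eta>"
        using eta_pos by (simp add: real_sqrt_divide divide_right_mono)
      then show ?thesis using norm_x_diff_z_le[OF that(2-4)] by linarith
    qed
    have step: "norm (x i (k + Suc t) - x i (k + t)) \<le> r" if "t < T" "i \<in> I" for i t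
    proof -
      have "(norm (x i (Suc (k + t)) - z i (k + t)))\<^sup>2 \<le> perturbation (k + t)"
        unfolding perturbation_def using that finite_I
        by (intro member_le_sum[where f = "\<lambda>i. (norm (x i (Suc (k + t)) - z i (k + t)))\<^sup>2"]) auto
      also have "\<dots> \<le> R"
        using small[OF that(1)] dissipation_nonneg[of "k + t"] by simp
      finally have "norm (x i (Suc (k + t)) - z i (k + t)) \<le> sqrt R"
        by (rule real_le_rsqrt)
      moreover have "norm (x i (k + t) - z i (k + t)) \<le> sqrt R / sqrt \<eta>"
        using near_z[OF that that(2) self_weight[OF that(2)]] .
      moreover have "norm (x i (k + Suc t) - x i (k + t)) \<le>
          norm (x i (Suc (k + t)) - z i (k + t)) + norm (x i (k + t) - z i (k + t))"
        using norm_triangle_ineq4[of "x i (Suc (k + t)) - z i (k + t)" "x i (k + t) - z i (k + t)"]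
        by simp
      ultimately show ?thesis by (simp add: r_def s_def algebra_simps)
    qed
    have drift: "norm (x i (k + t) - x i k) \<le> t * r" if "t \<le> T" "i \<in> I" for i t
      using that(1)
    proof (induction t)
      case (Suc t)
      have "norm (x i (k + Suc t) - x i k) \<le> norm (x i (k + Suc t) - x i (k + t)) + norm (x i (k + t) - x i k)"
        using norm_triangle_ineq[of "x i (k + Suc t) - x i (k + t)" "x i (k + t) - x i k"] by simp
      also have "\<dots> \<le> r + t * r"
        using Suc step[of t i] that(2) by simp
      finally show ?case by (simp add: algebra_simps)
    qed simp
    \<comment> \<open>When the edge is active both endpoints are within \<open>r\<close> of the
      receiver's average, and each has drifted by at most \<open>T * r\<close> since time
      \<open>k\<close>.\<close>
    define \<delta> where "\<delta> = 2 * (T + 1) * r"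
    have edge: "norm (x j k - x i k) \<le> \<delta>" if e: "(j, i) \<in> E" for i j
    proof -
      have ij: "i \<in> I" "j \<in> I" using e E_subset by auto
      obtain t where t: "t < T" "\<eta> \<le> a i j (k + t)"
        using communication[OF e, of k] by (metis add.commute atLeastLessThan_iff le_iff_add nat_add_left_cancel_less)
      have "real t * r \<le> T * r" using t r by (intro mult_right_mono) auto
      then have "norm (x j (k + t) - x j k) \<le> T * r" "norm (x i (k + t) - x i k) \<le> T * r"
        using drift[of t j] drift[of t i] t ij by auto
      moreover have "sqrt R / sqrt \<eta> \<le> r" using R by (simp add: r_def s_def algebra_simps)
      then have "norm (x j (k + t) - z i (k + t)) \<le> r" "norm (x i (k + t) - z i (k + t)) \<le> r"
        using near_z[of t i j] near_z[of t i i] t ij self_weight[OF ij(1)] by (auto intro: order_trans)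
      moreover have "norm (x j k - x i k) \<le> norm (x j (k + t) - z i (k + t)) + norm (x i (k + t) - z i (k + t))
          + norm (x j (k + t) - x j k) + norm (x i (k + t) - x i k)"
      proof -
        have four: "norm (p - q - u + w) \<le> norm p + norm q + norm u + norm w" for p q u w :: 'b
          using norm_triangle_ineq[of "p - q - u" w] norm_triangle_ineq4[of "p - q" u]
            norm_triangle_ineq4[of p q] by linarith
        have "x j k - x i k = (x j (k + t) - z i (k + t)) - (x i (k + t) - z i (k + t))
            - (x j (k + t) - x j k) + (x i (k + t) - x i k)"
          by simp
        then show ?thesis using four by metis
      qed
      ultimately show ?thesis by (simp add: \<delta>_def algebra_simps)
    qed
    have \<delta>: "\<delta> \<ge> 0" using r by (simp add: \<delta>_def)
    have path: "norm (x j k - x i k) \<le> n * \<delta>" if "(j, i) \<in> E ^^ n" for n i j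
      using that
    proof (induction n arbitrary: i)
      case (Suc n)
      then obtain l where "(j, l) \<in> E ^^ n" "(l, i) \<in> E" by auto
      then have "norm (x j k - x l k) \<le> n * \<delta>" "norm (x l k - x i k) \<le> \<delta>"
        using Suc.IH edge by auto
      then have "norm (x j k - x i k) \<le> n * \<delta> + \<delta>"
        using norm_triangle_ineq[of "x j k - x l k" "x l k - x i k"] by simp
      then show ?case by (simp add: algebra_simps)
    qed simp
    have finite_E: "finite E" using E_subset finite_I finite_subset by blast
    have all: "norm (x j k - x i k) \<le> card E * \<delta>" if ij: "i \<in> I" "j \<in> I" for i j
    proof -
      obtain n where "n \<le> card E" "(j, i) \<in> E ^^ n"
        using E_connected[OF ij(2,1)] unfolding rtrancl_finite_eq_relpow[OF finite_E] by blast
      moreover from this have "real n * \<delta> \<le> card E * \<delta>" using \<delta> by (intro mult_right_mono) auto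
      ultimately show ?thesis using path by (meson order_trans)
    qed
    obtain i where i: "i \<in> I" using I_nonempty by blast
    \<comment> \<open>The position of one agent serves as reference point instead of the
      mean.\<close>
    have "disagreement k \<le> (\<Sum>j\<in>I. (norm (x j k - x i k))\<^sup>2)"
      by (rule disagreement_le)
    also have "\<dots> \<le> (\<Sum>j\<in>I. (card E * \<delta>)\<^sup>2)"
      using all i by (intro sum_mono power_mono) auto
    also have "\<dots> = K * R"
      using R by (simp add: K_def \<delta>_def r_def power_mult_distrib)
    finally show ?thesis by (simp add: R_def)
  qed
  moreover have "K \<ge> 0" by (simp add: K_def)
  ultimately show ?thesis by blast
qed

text \<open>Summing the window bound controls the disagreement by dissipation and perturbation. The
  summed dissipation is bounded by telescoping, at the price of \<beta> times the summed
  disagreement, which a small \<beta> lets the left side absorb.\<close>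

lemma sum_disagreement_le:
  "\<exists>C1\<ge>0. \<exists>C2\<ge>0. \<forall>N. (\<Sum>k<N. disagreement (Suc k)) \<le> C1 + C2 * (\<Sum>k<N. perturbation k)"
proof -
  obtain K where K: "K \<ge> 0"
    "\<And>k. disagreement k \<le> K * (\<Sum>t<T. dissipation (k + t) + perturbation (k + t))"
    using disagreement_le_window by blast
  \<comment> \<open>Uniform bounds, which pay for the \<open>T\<close> indices by which the windows
    overshoot \<open>N\<close>.\<close>
  define W0 P0 where "W0 = card I * B\<^sup>2" and "P0 = card I * (2 * B)\<^sup>2"
  define \<beta> where "\<beta> = 1 / (2 * (K * T + 1))"
  have "K * T \<ge> 0" using K(1) by simp
  then have \<beta>: "\<beta> > 0" "K * T * \<beta> \<le> 1 / 2"
    by (auto simp: \<beta>_def divide_simps)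
  \<comment> \<open>The factor \<open>1 + 1 / \<beta>\<close> from telescoping, plus 1 for the
    perturbation already present in the window bound.\<close>
  define g where "g = 2 + 1 / \<beta>"
  have g: "g \<ge> 0" using \<beta> by (simp add: g_def)
  define C where "C = K * T * (W0 + \<beta> * (W0 + T * W0) + g * (T * P0))"
  have W0: "W0 \<ge> 0" and P0: "P0 \<ge> 0" by (auto simp: W0_def P0_def)
  have "(\<Sum>k<N. disagreement (Suc k)) \<le> 2 * C + 2 * (K * T * g) * (\<Sum>k<N. perturbation k)" for N
  proof -
    let ?M = "N + T"
    define S where "S = (\<Sum>k<N. disagreement (Suc k))"
    define Q where "Q = (\<Sum>k<N. perturbation k)"
    have telescope: "disagreement n + (\<Sum>k<n. dissipation k) \<le>
        disagreement 0 + \<beta> * (\<Sum>k<n. disagreement k) + (1 + 1 / \<beta>) * (\<Sum>k<n. perturbation k)" for n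
    proof (induction n)
      case (Suc n)
      then show ?case
        using dissipation_bound[OF \<beta>(1), of n] by (simp add: distrib_left)
    qed simp
    have "(\<Sum>k<?M. disagreement k) \<le> (\<Sum>k<N. disagreement k) + T * W0"
      by (intro sum_add_le_of_bounded) (simp add: W0_def disagreement_bounded)
    also have "(\<Sum>k<N. disagreement k) \<le> (\<Sum>k<Suc N. disagreement k)"
      using disagreement_nonneg by simp
    also have "\<dots> = disagreement 0 + S"
      unfolding S_def by (rule sum.lessThan_Suc_shift)
    also have "disagreement 0 \<le> W0"
      by (simp add: W0_def disagreement_bounded)
    finally have sumW: "(\<Sum>k<?M. disagreement k) \<le> W0 + S + T * W0" by simp
    have sumP: "(\<Sum>k<?M. perturbation k) \<le> Q + T * P0"
      unfolding Q_def by (intro sum_add_le_of_bounded) (simp only: P0_def perturbation_bounded)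
    have "S \<le> (\<Sum>k<N. K * (\<Sum>t<T. dissipation (Suc k + t) + perturbation (Suc k + t)))"
      unfolding S_def by (intro sum_mono K(2))
    also have "\<dots> = K * (\<Sum>k<N. \<Sum>t<T. dissipation (Suc k + t) + perturbation (Suc k + t))"
      by (simp only: sum_distrib_left)
    also have "\<dots> \<le> K * (T * (\<Sum>k<?M. dissipation k + perturbation k))"
      using K(1) dissipation_nonneg perturbation_nonneg
      by (intro mult_left_mono sum_window_le[where h = "\<lambda>k. dissipation k + perturbation k"]) auto
    also have "\<dots> = K * T * ((\<Sum>k<?M. dissipation k) + (\<Sum>k<?M. perturbation k))"
      by (simp add: sum.distrib)
    also have "\<dots> \<le> K * T * (W0 + \<beta> * (W0 + S + T * W0) + g * (Q + T * P0))"
    proof (rule mult_left_mono)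
      have "(\<Sum>k<?M. dissipation k) + (\<Sum>k<?M. perturbation k)
          \<le> disagreement 0 + \<beta> * (\<Sum>k<?M. disagreement k) + g * (\<Sum>k<?M. perturbation k)"
        using telescope[of ?M] disagreement_nonneg[of ?M] by (simp add: g_def algebra_simps)
      also have "\<dots> \<le> W0 + \<beta> * (W0 + S + T * W0) + g * (Q + T * P0)"
        using sumW sumP \<beta>(1) g
        by (intro add_mono mult_left_mono) (auto simp: W0_def disagreement_bounded)
      finally show "(\<Sum>k<?M. dissipation k) + (\<Sum>k<?M. perturbation k)
          \<le> W0 + \<beta> * (W0 + S + T * W0) + g * (Q + T * P0)" .
    qed (use K(1) in simp)
    also have "\<dots> = C + (K * T * \<beta>) * S + K * T * g * Q"
      by (simp add: C_def algebra_simps)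
    also have "(K * T * \<beta>) * S \<le> 1 / 2 * S"
      using \<beta>(2) disagreement_nonneg unfolding S_def by (intro mult_right_mono sum_nonneg) auto
    finally show ?thesis by (simp add: S_def Q_def)
  qed
  moreover have "2 * C \<ge> 0" "2 * (K * T * g) \<ge> 0"
    using K(1) \<beta>(1) g W0 P0 by (auto simp: C_def)
  ultimately show ?thesis by blast
qed

end

section \<open>Convergence of the proximal iterates\<close>

locale proximal_averaging = perturbed_averaging I a x z E T \<eta> B
  for I :: "'i set" and a :: "'i \<Rightarrow> 'i \<Rightarrow> nat \<Rightarrow> real"
    and x z :: "'i \<Rightarrow> nat \<Rightarrow> 'b::euclidean_space"
    and E :: "('i \<times> 'i) set" and T :: nat and \<eta> B :: real +
  fixes f :: "'i \<Rightarrow> 'b \<Rightarrow> real" and X :: "'i \<Rightarrow> 'b set" and c :: "nat \<Rightarrow> real"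
    and xbar :: 'b and \<rho> :: real
  assumes convex_f: "\<And>i. i \<in> I \<Longrightarrow> convex_on UNIV (f i)"
    and convex_X: "\<And>i. i \<in> I \<Longrightarrow> convex (X i)"
    and closed_X: "\<And>i. i \<in> I \<Longrightarrow> closed (X i)"
    and X_bounded: "\<And>i y. i \<in> I \<Longrightarrow> y \<in> X i \<Longrightarrow> norm y \<le> B"
    and ball_subset: "\<And>i. i \<in> I \<Longrightarrow> cball xbar \<rho> \<subseteq> X i"
    and rho_pos: "\<rho> > 0"
    and step_pos: "\<And>k. c k > 0"
    and step_sum: "filterlim (\<lambda>N. \<Sum>k<N. c k) at_top sequentially"
    and step_sq_sum: "summable (\<lambda>k. (c k)\<^sup>2)"
    and x_mem: "\<And>i k. i \<in> I \<Longrightarrow> x i k \<in> X i"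
    and x_prox: "\<And>i k. i \<in> I \<Longrightarrow>
      is_arg_min (\<lambda>y. f i y + 1 / (2 * c k) * (norm (z i k - y))\<^sup>2) (\<lambda>y. y \<in> X i) (x i (Suc k))"
begin

definition objective :: "'b \<Rightarrow> real" where
  "objective y = (\<Sum>i\<in>I. f i y)"

definition feasible :: "'b set" where
  "feasible = (\<Inter>i\<in>I. X i)"

definition sq_dist :: "'b \<Rightarrow> nat \<Rightarrow> real" where
  "sq_dist y k = (\<Sum>i\<in>I. (norm (x i k - y))\<^sup>2)"

lemma sq_dist_nonneg: "0 \<le> sq_dist y k"
  by (simp add: sq_dist_def sum_nonneg)

lemma norm_le_sqrt_sq_dist: "i \<in> I \<Longrightarrow> norm (x i k - y) \<le> sqrt (sq_dist y k)"
  unfolding sq_dist_def using finite_I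
  by (intro real_le_rsqrt member_le_sum[where f = "\<lambda>i. (norm (x i k - y))\<^sup>2"]) auto

lemma feasible_norm_le: "y \<in> feasible \<Longrightarrow> norm y \<le> B"
  using I_nonempty X_bounded by (auto simp: feasible_def)

lemma compact_feasible: "compact feasible"
  unfolding compact_eq_bounded_closed
proof
  show "bounded feasible" using feasible_norm_le by (auto simp: bounded_iff)
  show "closed feasible" unfolding feasible_def using closed_X by auto
qed

lemma xbar_feasible: "xbar \<in> feasible"
  using ball_subset rho_pos by (force simp: feasible_def)

lemma continuous_objective: "continuous_on UNIV objective"
  unfolding objective_def[abs_def]
  by (intro continuous_on_sum convex_on_continuous convex_f open_UNIV)

text \<open>The mean is within \<open>sqrt (disagreement k)\<close> of every \<open>X i\<close>;
  pulling it slightly towards \<open>xbar\<close> makes it feasible.\<close>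

lemma near_feasible_point:
  "\<exists>C\<ge>0. \<forall>k. \<exists>p\<in>feasible. \<forall>i\<in>I. norm (x i k - p) \<le> C * sqrt (disagreement k)"
proof -
  define C where "C = 1 + 2 * B / \<rho>"
  have B: "norm xbar \<le> B" using feasible_norm_le xbar_feasible by blast
  have "B \<ge> 0" using B norm_ge_zero order_trans by blast
  then have C: "C \<ge> 0" using rho_pos by (simp add: C_def)
  have "\<exists>p\<in>feasible. \<forall>i\<in>I. norm (x i k - p) \<le> C * sqrt (disagreement k)" for k
  proof -
    define s where "s = sqrt (disagreement k)"
    have s: "s \<ge> 0" by (simp add: s_def disagreement_nonneg)
    obtain p where p: "p \<in> (\<Inter>i\<in>I. X i)" "norm (mean k - p) \<le> s / \<rho> * norm (mean k - xbar)"
      using near_point_in_Inter[of I X "\<lambda>i. x i k" xbar \<rho> "mean k" s]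
        convex_X x_mem ball_subset rho_pos norm_diff_mean_le s by (auto simp: s_def)
    have "norm (mean k - xbar) \<le> 2 * B"
      using norm_triangle_ineq4[of "mean k" xbar] norm_mean_le[of k] B by simp
    then have "s / \<rho> * norm (mean k - xbar) \<le> s / \<rho> * (2 * B)"
      using s rho_pos by (intro mult_left_mono) auto
    then have mp: "norm (mean k - p) \<le> s / \<rho> * (2 * B)" using p(2) by simp
    have "norm (x i k - p) \<le> C * s" if "i \<in> I" for i
      using norm_triangle_ineq[of "x i k - mean k" "mean k - p"] mp norm_diff_mean_le[OF that, of k]
      by (simp add: C_def s_def algebra_simps)
    then show ?thesis using p(1) by (auto simp: feasible_def s_def)
  qed
  then show ?thesis using C by blast
qed

text \<open>The proximal inequality evaluates each \<open>f i\<close> at that agent's own new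
  iterate. The Lipschitz bounds move all of them to the common point \<open>p (Suc k)\<close>, at a
  cost proportional to the new distances; summing over the agents produces the objective. Neither
  \<open>p\<close> nor \<open>M\<close> depends on \<open>y\<close>.\<close>

lemma descent:
  "\<exists>p C M. M \<ge> 0 \<and> (\<forall>k. p k \<in> feasible) \<and>
    (\<forall>i\<in>I. \<forall>k. norm (x i k - p k) \<le> C * sqrt (disagreement k)) \<and>
    (\<forall>y\<in>feasible. \<forall>k. sq_dist y (Suc k) + perturbation k + 2 * c k * (objective (p (Suc k)) - objective y)
      \<le> sq_dist y k + 2 * c k * (M * sqrt (disagreement (Suc k))))"
proof -
  obtain C where C: "C \<ge> 0"
    "\<And>k. \<exists>p\<in>feasible. \<forall>i\<in>I. norm (x i k - p) \<le> C * sqrt (disagreement k)"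
    using near_feasible_point by blast
  then obtain p where p: "\<And>k. p k \<in> feasible"
    "\<And>k i. i \<in> I \<Longrightarrow> norm (x i k - p k) \<le> C * sqrt (disagreement k)"
    by metis
  have "\<forall>i\<in>I. \<exists>L\<ge>0. \<forall>y z. norm y \<le> B \<longrightarrow> norm z \<le> B \<longrightarrow> f i y - f i z \<le> L * norm (y - z)"
    using convex_on_UNIV_imp_lipschitz_cball[OF convex_f] by metis
  then obtain L where L: "\<And>i. i \<in> I \<Longrightarrow> L i \<ge> 0"
    "\<And>i y z. i \<in> I \<Longrightarrow> norm y \<le> B \<Longrightarrow> norm z \<le> B \<Longrightarrow> f i y - f i z \<le> L i * norm (y - z)"
    by metis
  define M where "M = (\<Sum>i\<in>I. L i * C)"
  have M: "M \<ge> 0" using L(1) C(1) by (auto simp: M_def intro!: sum_nonneg)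
  have "sq_dist y (Suc k) + perturbation k + 2 * c k * (objective (p (Suc k)) - objective y)
      \<le> sq_dist y k + 2 * c k * (M * sqrt (disagreement (Suc k)))" if y: "y \<in> feasible" for y k
  proof -
    define s where "s = sqrt (disagreement (Suc k))"
    have "(norm (x i (Suc k) - y))\<^sup>2 + (norm (x i (Suc k) - z i k))\<^sup>2 + 2 * c k * (f i (p (Suc k)) - f i y)
        \<le> (norm (z i k - y))\<^sup>2 + 2 * c k * (L i * C * s)" if i: "i \<in> I" for i
    proof -
      have "f i (p (Suc k)) - f i (x i (Suc k)) \<le> L i * norm (p (Suc k) - x i (Suc k))"
        using L(2)[OF i] feasible_norm_le p(1) x_bounded[OF i] by blast
      also have "\<dots> \<le> L i * (C * s)"
        using p(2)[OF i, of "Suc k"] L(1)[OF i] by (intro mult_left_mono) (auto simp: s_def norm_minus_commute)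
      finally have "2 * c k * (f i (p (Suc k)) - f i y) \<le> 2 * c k * (f i (x i (Suc k)) - f i y + L i * C * s)"
        using step_pos[of k] by (intro mult_left_mono) auto
      moreover have "2 * c k * (f i (x i (Suc k)) - f i y)
          \<le> (norm (z i k - y))\<^sup>2 - (norm (x i (Suc k) - y))\<^sup>2 - (norm (x i (Suc k) - z i k))\<^sup>2"
        using y i convex_X[OF i] step_pos x_prox[OF i] convex_on_subset[OF convex_f[OF i]]
        by (intro prox_inequality[where S = "X i"]) (auto simp: feasible_def)
      ultimately show ?thesis by (simp add: algebra_simps)
    qed
    then have "(\<Sum>i\<in>I. (norm (x i (Suc k) - y))\<^sup>2 + (norm (x i (Suc k) - z i k))\<^sup>2 + 2 * c k * (f i (p (Suc k)) - f i y))
        \<le> (\<Sum>i\<in>I. (norm (z i k - y))\<^sup>2 + 2 * c k * (L i * C * s))"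
      by (rule sum_mono)
    then have "sq_dist y (Suc k) + perturbation k + 2 * c k * (objective (p (Suc k)) - objective y)
        \<le> (\<Sum>i\<in>I. (norm (z i k - y))\<^sup>2) + 2 * c k * (M * s)"
      unfolding sum.distrib sum_distrib_left[symmetric] sum_subtractf sum_distrib_right[symmetric]
      by (simp only: sq_dist_def perturbation_def objective_def M_def sum_distrib_right)
    moreover have "(\<Sum>i\<in>I. (norm (z i k - y))\<^sup>2) \<le> sq_dist y k"
      using sum_norm_z_diff[of k y] dissipation_nonneg[of k] by (simp add: sq_dist_def)
    ultimately show ?thesis by (simp add: s_def)
  qed
  then show ?thesis using M p by blast
qed

lemma convergence:
  "\<exists>xs. is_arg_min objective (\<lambda>y. y \<in> feasible) xs \<and> (\<forall>i\<in>I. (\<lambda>k. norm (x i k - xs)) \<longlonglongrightarrow> 0)"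
proof -
  obtain p C M where M: "M \<ge> 0" and p: "\<And>k. p k \<in> feasible"
    "\<And>i k. i \<in> I \<Longrightarrow> norm (x i k - p k) \<le> C * sqrt (disagreement k)"
    and desc: "\<And>y k. y \<in> feasible \<Longrightarrow>
      sq_dist y (Suc k) + perturbation k + 2 * c k * (objective (p (Suc k)) - objective y)
      \<le> sq_dist y k + 2 * c k * (M * sqrt (disagreement (Suc k)))"
    using descent by metis
  obtain y0 where y0: "y0 \<in> feasible" "\<And>y. y \<in> feasible \<Longrightarrow> objective y0 \<le> objective y"
    using continuous_attains_inf[OF compact_feasible _ continuous_on_subset[OF continuous_objective]]
      xbar_feasible by blast
  define G where "G k = objective (p (Suc k)) - objective y0" for k
  have G: "G k \<ge> 0" for k using y0 p(1) by (simp add: G_def)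
  obtain C1 C2 where C12: "C1 \<ge> 0" "C2 \<ge> 0"
    "\<And>N. (\<Sum>k<N. disagreement (Suc k)) \<le> C1 + C2 * (\<Sum>k<N. perturbation k)"
    using sum_disagreement_le by blast
  \<comment> \<open>Chosen so that \<alpha> times the summed disagreement costs at most half of the
    summed perturbation.\<close>
  define \<alpha> where "\<alpha> = 1 / (2 * (C2 + 1))"
  have \<alpha>: "\<alpha> > 0" "\<alpha> * C2 \<le> 1 / 2" using C12(2) by (auto simp: \<alpha>_def divide_simps)
  define b where "b k = \<alpha> * disagreement (Suc k) + M\<^sup>2 / \<alpha> * (c k)\<^sup>2" for k
  \<comment> \<open>Stated for every minimizer \<open>y\<close>, since it is used first for
    \<open>y0\<close> and later for the limit point \<open>xs\<close>.\<close>
  have fejer: "sq_dist y (Suc k) + perturbation k + 2 * (c k * G k) \<le> sq_dist y k + b k"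
    if "y \<in> feasible" "objective y \<le> objective y0" for y k
  proof -
    define s where "s = sqrt (disagreement (Suc k))"
    have "0 \<le> (\<alpha> * s - M * c k)\<^sup>2 / \<alpha>" using \<alpha> by simp
    also have "\<dots> = \<alpha> * s\<^sup>2 - 2 * c k * (M * s) + M\<^sup>2 / \<alpha> * (c k)\<^sup>2"
      using \<alpha> by (simp add: power2_eq_square field_simps)
    finally have "2 * c k * (M * s) \<le> b k"
      by (simp add: b_def s_def disagreement_nonneg)
    moreover have "2 * (c k * G k) \<le> 2 * c k * (objective (p (Suc k)) - objective y)"
      using that(2) step_pos[of k] by (simp add: G_def)
    ultimately show ?thesis using desc[OF that(1), of k] by (simp add: s_def)
  qed
  define K where "K = sq_dist y0 0 + \<alpha> * C1 + M\<^sup>2 / \<alpha> * (\<Sum>k. (c k)\<^sup>2)"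
  \<comment> \<open>Half of the perturbation survives, so this one bound controls both the
    perturbations and the weighted objective gaps.\<close>
  have energy: "1 / 2 * (\<Sum>k<N. perturbation k) + 2 * (\<Sum>k<N. c k * G k) \<le> K" for N
  proof -
    have "sq_dist y0 N + (\<Sum>k<N. perturbation k) + 2 * (\<Sum>k<N. c k * G k) \<le> sq_dist y0 0 + (\<Sum>k<N. b k)"
    proof (induction N)
      case (Suc N)
      then show ?case using fejer[OF y0(1), of N] by simp
    qed simp
    moreover have "(\<Sum>k<N. b k) = \<alpha> * (\<Sum>k<N. disagreement (Suc k)) + M\<^sup>2 / \<alpha> * (\<Sum>k<N. (c k)\<^sup>2)"
      by (simp add: b_def sum.distrib sum_distrib_left)
    moreover have "\<alpha> * (\<Sum>k<N. disagreement (Suc k)) \<le> \<alpha> * C1 + 1 / 2 * (\<Sum>k<N. perturbation k)"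
    proof -
      have "\<alpha> * (\<Sum>k<N. disagreement (Suc k)) \<le> \<alpha> * (C1 + C2 * (\<Sum>k<N. perturbation k))"
        using C12(3) \<alpha> by (intro mult_left_mono) auto
      moreover have "\<alpha> * C2 * (\<Sum>k<N. perturbation k) \<le> 1 / 2 * (\<Sum>k<N. perturbation k)"
        using \<alpha>(2) perturbation_nonneg by (intro mult_right_mono sum_nonneg) auto
      ultimately show ?thesis by (simp add: algebra_simps)
    qed
    moreover have "M\<^sup>2 / \<alpha> * (\<Sum>k<N. (c k)\<^sup>2) \<le> M\<^sup>2 / \<alpha> * (\<Sum>k. (c k)\<^sup>2)"
      using \<alpha> step_sq_sum by (intro mult_left_mono sum_le_suminf) auto
    ultimately show ?thesis
      using sq_dist_nonneg[of y0 N] by (simp add: K_def)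
  qed
  have cG: "(\<Sum>k<N. c k * G k) \<ge> 0" for N
    using G step_pos by (intro sum_nonneg mult_nonneg_nonneg) (auto intro: less_imp_le)
  have P_le: "(\<Sum>k<N. perturbation k) \<le> 2 * K" for N
    using energy[of N] cG[of N] by simp
  have cG_le: "(\<Sum>k<N. c k * G k) \<le> K" for N
    using energy[of N] cG[of N] sum_nonneg[of "{..<N}" perturbation] perturbation_nonneg by simp
  have "(\<Sum>k<N. disagreement (Suc k)) \<le> C1 + C2 * (2 * K)" for N
    using C12(3)[of N] mult_left_mono[OF P_le[of N] C12(2)] by linarith
  then have summable_W: "summable (\<lambda>k. disagreement (Suc k))"
    by (intro summableI_nonneg_bounded disagreement_nonneg)
  then have "(\<lambda>k. disagreement (Suc k)) \<longlonglongrightarrow> 0"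
    by (rule summable_LIMSEQ_zero)
  then have W: "disagreement \<longlonglongrightarrow> 0"
    by (rule LIMSEQ_imp_Suc)
  have "summable b"
    unfolding b_def[abs_def] using summable_W step_sq_sum by (intro summable_add summable_mult)
  have conv: "convergent (sq_dist y)" if "y \<in> feasible" "objective y \<le> objective y0" for y
  proof (rule quasi_Fejer_convergent[OF sq_dist_nonneg _ \<open>summable b\<close>])
    show "sq_dist y (Suc k) \<le> sq_dist y k + b k" for k
      using fejer[OF that, of k] perturbation_nonneg[of k]
        mult_nonneg_nonneg[OF less_imp_le[OF step_pos[of k]] G[of k]] by simp
  qed
  have "\<exists>k\<ge>n. G k < 1 / (real n + 1)" for n
    by (rule frequently_small_of_weighted_sum_bounded[OF step_pos step_sum cG_le]) simp
  then obtain \<kappa> where \<kappa>: "\<And>n. n \<le> \<kappa> n" "\<And>n. G (\<kappa> n) < 1 / (real n + 1)"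
    by metis
  obtain xs r where xs: "xs \<in> feasible" "strict_mono r" "((\<lambda>n. p (Suc (\<kappa> n))) \<circ> r) \<longlonglongrightarrow> xs"
    using compact_imp_seq_compact[OF compact_feasible] p(1) unfolding seq_compact_def by metis
  \<comment> \<open>The successor appears because \<open>G k\<close> measures the gap at
    \<open>p (Suc k)\<close>.\<close>
  define \<nu> where "\<nu> n = Suc (\<kappa> (r n))" for n
  have r: "n \<le> r n" for n using xs(2) by (rule seq_suble)
  have p_lim: "(\<lambda>n. p (\<nu> n)) \<longlonglongrightarrow> xs" using xs(3) by (simp add: \<nu>_def o_def)
  have "n \<le> \<nu> n" for n
    unfolding \<nu>_def using r \<kappa>(1) le_SucI order_trans by blast
  then have \<nu>: "filterlim \<nu> at_top sequentially"
    by (intro filterlim_at_top_mono[OF filterlim_ident]) auto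
  \<comment> \<open>Hence \<open>xs\<close> is itself a minimizer and \<open>conv\<close> applies to
    it: the whole sequence \<open>sq_dist xs\<close> converges.\<close>
  have "objective xs \<le> objective y0"
  proof (rule LIMSEQ_le)
    show "(\<lambda>n. objective (p (\<nu> n))) \<longlonglongrightarrow> objective xs"
      using continuous_objective
      by (intro isCont_tendsto_compose[OF _ p_lim]) (simp add: continuous_on_eq_continuous_at)
    have "(\<lambda>n. objective y0 + 1 / (real n + 1)) \<longlonglongrightarrow> objective y0 + 0"
      using LIMSEQ_inverse_real_of_nat
      by (intro tendsto_add tendsto_const) (simp add: inverse_eq_divide add.commute)
    then show "(\<lambda>n. objective y0 + 1 / (real n + 1)) \<longlonglongrightarrow> objective y0" by simp
    have "objective (p (\<nu> n)) \<le> objective y0 + 1 / (real n + 1)" for n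
    proof -
      have "1 / (real (r n) + 1) \<le> 1 / (real n + 1)"
        using r[of n] by (intro divide_left_mono) auto
      then show ?thesis using \<kappa>(2)[of "r n"] by (simp add: G_def \<nu>_def)
    qed
    then show "\<exists>N. \<forall>n\<ge>N. objective (p (\<nu> n)) \<le> objective y0 + 1 / (real n + 1)" by blast
  qed
  then obtain l where l: "sq_dist xs \<longlonglongrightarrow> l"
    using conv xs(1) convergentD by blast
  \<comment> \<open>Vanishing along \<nu> is enough to identify the limit \<open>l\<close> of the
    whole sequence.\<close>
  have "(\<lambda>n. sq_dist xs (\<nu> n)) \<longlonglongrightarrow> 0"
  proof (rule tendsto_sandwich[OF _ _ tendsto_const])
    have "(\<lambda>n. disagreement (\<nu> n)) \<longlonglongrightarrow> 0" using W \<nu> by (rule filterlim_compose)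
    then have "(\<lambda>n. \<Sum>i\<in>I. (C * sqrt (disagreement (\<nu> n)) + norm (p (\<nu> n) - xs))\<^sup>2)
        \<longlonglongrightarrow> (\<Sum>i\<in>I. (C * sqrt 0 + norm (xs - xs))\<^sup>2)"
      using p_lim by (intro tendsto_intros)
    then show "(\<lambda>n. \<Sum>i\<in>I. (C * sqrt (disagreement (\<nu> n)) + norm (p (\<nu> n) - xs))\<^sup>2) \<longlonglongrightarrow> 0" by simp
    have "norm (x i k - xs) \<le> C * sqrt (disagreement k) + norm (p k - xs)" if "i \<in> I" for i k
      using norm_triangle_ineq[of "x i k - p k" "p k - xs"] p(2)[OF that, of k] by simp
    then have "sq_dist xs k \<le> (\<Sum>i\<in>I. (C * sqrt (disagreement k) + norm (p k - xs))\<^sup>2)" for k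
      unfolding sq_dist_def by (intro sum_mono power_mono) auto
    then show "\<forall>\<^sub>F n in sequentially. sq_dist xs (\<nu> n)
        \<le> (\<Sum>i\<in>I. (C * sqrt (disagreement (\<nu> n)) + norm (p (\<nu> n) - xs))\<^sup>2)" by simp
  qed (auto simp: sq_dist_nonneg)
  moreover have "(\<lambda>n. sq_dist xs (\<nu> n)) \<longlonglongrightarrow> l" using l \<nu> by (rule filterlim_compose)
  ultimately have "l = 0" using LIMSEQ_unique by blast
  then have "(\<lambda>k. sqrt (sq_dist xs k)) \<longlonglongrightarrow> 0"
    using tendsto_real_sqrt[OF l] by simp
  then have "(\<lambda>k. norm (x i k - xs)) \<longlonglongrightarrow> 0" if "i \<in> I" for i
    by (rule Lim_null_comparison[rotated]) (simp add: norm_le_sqrt_sq_dist[OF that])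
  moreover have "is_arg_min objective (\<lambda>y. y \<in> feasible) xs"
    using xs(1) \<open>objective xs \<le> objective y0\<close> y0(2) by (force simp: is_arg_min_def)
  ultimately show ?thesis by blast
qed

end

section \<open>Application to the agents \<open>1, ..., m\<close>\<close>

theorem theorem1:
  fixes m :: nat
    and f :: "nat \<Rightarrow> real ^ 'n \<Rightarrow> real"
    and X :: "nat \<Rightarrow> (real ^ 'n) set"
    and a :: "nat \<Rightarrow> nat \<Rightarrow> nat \<Rightarrow> real"
    and c :: "nat \<Rightarrow> real"
    and x z :: "nat \<Rightarrow> nat \<Rightarrow> real ^ 'n"
  assumes m_pos: "m \<ge> 1"
    and convexity: "\<forall>i\<in>{1..m}. convex_on UNIV (f i) \<and> convex (X i)"
    and connectivity: "strongly_connected (with_proj (graph_inf m a))"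
    and communication:
      "\<exists>T\<ge>1. \<forall>(j, i)\<in>edges_inf m a. \<forall>k. \<exists>r\<in>{k..k + T - 1}. (j, i) \<in> edges_at m a r"
    and compactness: "\<forall>i\<in>{1..m}. compact (X i)"
    and interior_point:
      "\<exists>xbar\<in>(\<Inter>i\<in>{1..m}. X i). \<exists>\<rho>>0. {y. norm (y - xbar) < \<rho>} \<subseteq> (\<Inter>i\<in>{1..m}. X i)"
    and c_pos: "\<forall>k. c k > 0"
    and c_noninc: "decseq c"
    and c_sum: "filterlim (\<lambda>N. \<Sum>k<N. c k) at_top sequentially"
    and c_sq_sum: "summable (\<lambda>k. (c k)\<^sup>2)"
    and weights_bound:
      "\<exists>\<eta>. 0 < \<eta> \<and> \<eta> < 1 \<and>
         (\<forall>i\<in>{1..m}. \<forall>j\<in>{1..m}. \<forall>k.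
            a i j k \<ge> 0 \<and> a i i k \<ge> \<eta> \<and> (a i j k > 0 \<longrightarrow> a i j k \<ge> \<eta>))"
    and weights_row: "\<forall>k. \<forall>i\<in>{1..m}. (\<Sum>j=1..m. a i j k) = 1"
    and weights_col: "\<forall>k. \<forall>j\<in>{1..m}. (\<Sum>i=1..m. a i j k) = 1"
    and x_init: "\<forall>i\<in>{1..m}. x i 0 \<in> X i"
    and z_def: "\<forall>k. \<forall>i\<in>{1..m}. z i k = (\<Sum>j=1..m. a i j k *\<^sub>R x j k)"
    and x_step:
      "\<forall>k. \<forall>i\<in>{1..m}.
         is_arg_min (\<lambda>y. f i y + 1 / (2 * c k) * (norm (z i k - y))\<^sup>2) (\<lambda>y. y \<in> X i) (x i (Suc k))"
  shows "\<exists>xs\<in>minimizers m f X. \<forall>i\<in>{1..m}. (\<lambda>k. norm (x i k - xs)) \<longlonglongrightarrow> 0"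
proof -
  let ?I = "{1..m}"
  obtain T where T: "T \<ge> 1"
    "\<And>i j k. (j, i) \<in> edges_inf m a \<Longrightarrow> \<exists>r\<in>{k..k + T - 1}. (j, i) \<in> edges_at m a r"
    using communication by blast
  obtain \<eta> where \<eta>: "\<eta> > 0" "\<And>i j k. i \<in> ?I \<Longrightarrow> j \<in> ?I \<Longrightarrow>
      a i j k \<ge> 0 \<and> a i i k \<ge> \<eta> \<and> (a i j k > 0 \<longrightarrow> a i j k \<ge> \<eta>)"
    using weights_bound by blast
  obtain xbar \<rho> where \<rho>: "\<rho> > 0" "{y. norm (y - xbar) < \<rho>} \<subseteq> (\<Inter>i\<in>?I. X i)"
    using interior_point by blast
  have "bounded (\<Union>i\<in>?I. X i)"
    using compactness by (intro bounded_UN) (auto intro: compact_imp_bounded)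
  then obtain B where B: "\<And>i y. i \<in> ?I \<Longrightarrow> y \<in> X i \<Longrightarrow> norm y \<le> B"
    unfolding bounded_iff by (meson UN_iff)
  have x_mem: "x i k \<in> X i" if "i \<in> ?I" for i k
    using x_init x_step that by (cases k) (auto simp: is_arg_min_def)
  have edge_weight: "j \<in> ?I \<and> i \<in> ?I \<and> \<eta> \<le> a i j k" if "(j, i) \<in> edges_at m a k" for i j k
    using that \<eta>(2) by (auto simp: edges_at_def)
  have edges_subset: "edges_inf m a \<subseteq> ?I \<times> ?I"
  proof clarify
    fix j i assume "(j, i) \<in> edges_inf m a"
    \<comment> \<open>Any window contains a time at which the edge is active, and active edges join
      agents.\<close>
    then obtain k where "(j, i) \<in> edges_at m a k" using T(2) by blast
    then show "j \<in> ?I \<and> i \<in> ?I" using edge_weight by blast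
  qed
  have connected: "(i, j) \<in> (edges_inf m a)\<^sup>*" if "i \<in> ?I" "j \<in> ?I" for i j
  proof -
    have "i \<rightarrow>\<^sup>*\<^bsub>with_proj (graph_inf m a)\<^esub> j"
      using connectivity that by (simp add: strongly_connected_def graph_inf_def)
    then have "(i, j) \<in> (arcs_ends (with_proj (graph_inf m a)))\<^sup>*"
      unfolding reachable_def by (rule rtrancl_on_rtranclI)
    then show ?thesis by (simp add: arcs_ends_def arc_to_ends_def graph_inf_def)
  qed
  \<comment> \<open>Halving the radius places a closed ball inside the given open one.\<close>
  interpret proximal_averaging ?I a x z "edges_inf m a" T \<eta> B f X c xbar "\<rho> / 2"
  proof
    show "finite ?I" by simp
    show "?I \<noteq> {}" using m_pos by simp
    show "0 \<le> a i j k" if "i \<in> ?I" "j \<in> ?I" for i j k using \<eta>(2)[OF that] by blast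
    show "(\<Sum>j\<in>?I. a i j k) = 1" if "i \<in> ?I" for i k using weights_row that by blast
    show "(\<Sum>i\<in>?I. a i j k) = 1" if "j \<in> ?I" for j k using weights_col that by blast
    show "\<eta> > 0" by (fact \<eta>(1))
    show "\<eta> \<le> a i i k" if "i \<in> ?I" for i k using \<eta>(2)[OF that that] by blast
    show "z i k = (\<Sum>j\<in>?I. a i j k *\<^sub>R x j k)" if "i \<in> ?I" for i k using z_def that by blast
    show "edges_inf m a \<subseteq> ?I \<times> ?I" by (fact edges_subset)
    show "(i, j) \<in> (edges_inf m a)\<^sup>*" if "i \<in> ?I" "j \<in> ?I" for i j
      using that by (rule connected)
    show "\<exists>r\<in>{k..<k + T}. \<eta> \<le> a i j r" if e: "(j, i) \<in> edges_inf m a" for i j k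
    proof -
      \<comment> \<open>As \<open>T \<ge> 1\<close>, the truncated subtraction is harmless and
        \<open>{k..k + T - 1}\<close> equals \<open>{k..<k + T}\<close>.\<close>
      obtain r where "r \<in> {k..k + T - 1}" "(j, i) \<in> edges_at m a r" using T(2)[OF e] by blast
      then show ?thesis using T(1) edge_weight by (intro bexI[of _ r]) auto
    qed
    show "norm (x i k) \<le> B" if "i \<in> ?I" for i k
      using B[OF that x_mem[OF that]] .
    show "convex_on UNIV (f i)" "convex (X i)" if "i \<in> ?I" for i
      using convexity that by blast+
    show "closed (X i)" if "i \<in> ?I" for i
      using compactness that compact_imp_closed by blast
    show "norm y \<le> B" if "i \<in> ?I" "y \<in> X i" for i y using B[OF that] .
    show "cball xbar (\<rho> / 2) \<subseteq> X i" if "i \<in> ?I" for i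
    proof
      fix y assume "y \<in> cball xbar (\<rho> / 2)"
      then have "norm (y - xbar) < \<rho>" using \<rho>(1) by (simp add: dist_norm norm_minus_commute)
      then show "y \<in> X i" using \<rho>(2) that by blast
    qed
    show "\<rho> / 2 > 0" using \<rho>(1) by simp
    show "c k > 0" for k using c_pos by blast
    show "filterlim (\<lambda>N. \<Sum>k<N. c k) at_top sequentially" by (fact c_sum)
    show "summable (\<lambda>k. (c k)\<^sup>2)" by (fact c_sq_sum)
    show "x i k \<in> X i" if "i \<in> ?I" for i k using that by (rule x_mem)
    show "is_arg_min (\<lambda>y. f i y + 1 / (2 * c k) * (norm (z i k - y))\<^sup>2) (\<lambda>y. y \<in> X i) (x i (Suc k))"
      if "i \<in> ?I" for i k using x_step that by blast
  qed
  show ?thesis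
    using convergence unfolding minimizers_def objective_def[abs_def] feasible_def by blast
qed

end
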